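(* Let $f^k\in\mathcal{S}_0^{n-1}$, let $v^k\in\partial_0\|f^k\|_1$, put $g^k=f^k+v^k$ and $\theta\in(0,1)$, and let $$H^k:=\underset{u\in\mathbb{R}^n}{\arg\min}\left\{\|u\|_{TV}+\frac{E(f^k)}{2}\|u-g^k\|_2^2\right\}.$$ Let $(\Phi^m_k)_{m\ge 1}$ be any sequence in $\mathbb{R}^n$ with $\Phi^1_k=f^k$ and $\Phi^m_k\to H^k$ as $m\to\infty$. If $H^k\neq f^k$, then for all sufficiently large $m$ the vector $\Phi^m_k$ is non-constant and satisfies the stopping condition $$E(\Phi^m_k)+\frac{\theta\,E(f^k)\,\|\Phi^m_k-f^k\|_2^2}{\|\Phi^m_k-\mathrm{med}(\Phi^m_k)\mathbf{1}\|_1}<E(f^k),$$ so that the stopping condition is reached after finitely many inner iterations. Moreover the energy strictly decreases in the outer step: if $h^k=\Phi^{M_k}_k$, where $M_k$ is the first index at which the stopping condition holds, and $h^k_0=h^k-\mathrm{med}(h^k)\mathbf{1}$, $f^{k+1}=h^k_0/\|h^k_0\|_2$, then $E(f^{k+1})<E(f^k)$.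
   Context: $V=\{x_1,\dots,x_n\}$ is the vertex set of a connected weighted graph with nonnegative symmetric weights $w_{i,j}$; functions $f:V\to\mathbb{R}$ are identified with vectors in $\mathbb{R}^n$, and $\mathbf{1}$ is the all-ones vector. $\|f\|_{TV}=\sum_{i,j}w_{i,j}|f(x_i)-f(x_j)|$; $\|f\|_1=\sum_i|f(x_i)|$; $\|\cdot\|_2$ is the Euclidean norm; $\mathrm{med}(f)$ is the median of $f$ (the $(n/2)$-th smallest entry when $n$ is even). For non-constant $f\in\mathbb{R}^n$, the TV-Balanced Cut energy is $E(f)=\|f\|_{TV}/\|f-\mathrm{med}(f)\mathbf{1}\|_1$. $\mathcal{S}_0^{n-1}=\{f\in\mathbb{R}^n:\|f\|_2=1,\ \mathrm{med}(f)=0\}$. $\partial\|f\|_1=\{v\in\mathbb{R}^n:\|g\|_1-\|f\|_1\ge\langle v,g-f\rangle\ \forall g\in\mathbb{R}^n\}$ is the subdifferential of the $\ell_1$ norm at $f$, and $\partial_0\|f\|_1$ denotes the set of its elements with zero mean. *)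

theory Defs
  imports "HOL-Analysis.Analysis" "HOL-Library.Multiset"
begin

text \<open>The vertex set is the finite type 'n, so that functions on the vertices are
  vectors of type real ^ 'n; the all-ones vector is the library's 1 :: real ^ 'n.\<close>

definition connected_weighted_graph :: "('n::finite \<Rightarrow> 'n \<Rightarrow> real) \<Rightarrow> bool" where
  "connected_weighted_graph w \<longleftrightarrow>
     (\<forall>i j. 0 \<le> w i j) \<and> (\<forall>i j. w i j = w j i) \<and>
     (\<forall>i j. (i, j) \<in> {(a, b). 0 < w a b}\<^sup>*)"

definition nonconstant :: "real ^ 'n \<Rightarrow> bool" where
  "nonconstant f \<longleftrightarrow> (\<exists>i j. f $ i \<noteq> f $ j)"

definition tv_norm :: "('n::finite \<Rightarrow> 'n \<Rightarrow> real) \<Rightarrow> real ^ 'n \<Rightarrow> real" where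
  "tv_norm w f = (\<Sum>i\<in>UNIV. \<Sum>j\<in>UNIV. w i j * \<bar>f $ i - f $ j\<bar>)"

definition l1_norm :: "real ^ 'n::finite \<Rightarrow> real" where
  "l1_norm f = (\<Sum>i\<in>UNIV. \<bar>f $ i\<bar>)"

text \<open>List positions count from 0: for n = CARD('n) this is the (n/2)-th smallest entry
  when n is even and the ((n+1)/2)-th smallest entry when n is odd.\<close>

definition med :: "real ^ 'n::finite \<Rightarrow> real" where
  "med f = sorted_list_of_multiset (image_mset (($) f) (mset_set UNIV))
             ! ((CARD('n) + 1) div 2 - 1)"

definition median_centered :: "real ^ 'n::finite \<Rightarrow> real ^ 'n" where
  "median_centered f = f - med f *\<^sub>R 1"

text \<open>Only meaningful for non-constant f; for constant f the denominator vanishes and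
  the value is 0 by the convention x / 0 = 0.\<close>

definition balanced_cut_energy :: "('n::finite \<Rightarrow> 'n \<Rightarrow> real) \<Rightarrow> real ^ 'n \<Rightarrow> real" where
  "balanced_cut_energy w f = tv_norm w f / l1_norm (median_centered f)"

definition median_zero_sphere :: "(real ^ 'n::finite) set" where
  "median_zero_sphere = {f. norm f = 1 \<and> med f = 0}"

definition l1_subdifferential :: "real ^ 'n::finite \<Rightarrow> (real ^ 'n) set" where
  "l1_subdifferential f = {v. \<forall>g. l1_norm g - l1_norm f \<ge> v \<bullet> (g - f)}"

definition mean :: "real ^ 'n::finite \<Rightarrow> real" where
  "mean v = (\<Sum>i\<in>UNIV. v $ i) / real CARD('n)"

definition l1_subdifferential0 :: "real ^ 'n::finite \<Rightarrow> (real ^ 'n) set" where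
  "l1_subdifferential0 f = {v \<in> l1_subdifferential f. mean v = 0}"

text \<open>The minimised function is strictly convex and coercive when the energy of f is
  positive, so the choice made by the library's arg_min is the unique minimiser.\<close>

definition inner_argmin ::
    "('n::finite \<Rightarrow> 'n \<Rightarrow> real) \<Rightarrow> real ^ 'n \<Rightarrow> real ^ 'n \<Rightarrow> real ^ 'n" where
  "inner_argmin w f g =
     arg_min (\<lambda>u. tv_norm w u + balanced_cut_energy w f / 2 * (norm (u - g))\<^sup>2) (\<lambda>_. True)"

text \<open>Non-constancy of u is part of the condition because the energy of u is undefined
  otherwise; without it the convention x / 0 = 0 would make constant vectors satisfy the
  inequality.\<close>

definition stopping_condition ::
    "('n::finite \<Rightarrow> 'n \<Rightarrow> real) \<Rightarrow> real \<Rightarrow> real ^ 'n \<Rightarrow> real ^ 'n \<Rightarrow> bool" where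
  "stopping_condition w \<theta> f u \<longleftrightarrow>
     nonconstant u \<and>
     balanced_cut_energy w u
       + \<theta> * balanced_cut_energy w f * (norm (u - f))\<^sup>2 / l1_norm (median_centered u)
     < balanced_cut_energy w f"

definition outer_update :: "real ^ 'n::finite \<Rightarrow> real ^ 'n" where
  "outer_update h = (let h0 = median_centered h in (1 / norm h0) *\<^sub>R h0)"

end

theory Submission imports Defs begin

text \<open>Write \<open>D u\<close> for the \<open>l1\<close> norm of \<open>u - med u\<close> and \<open>E\<close> for the (positive) energy of \<open>f\<close>.

  Optimality of \<open>H\<close> in the proximal problem says that \<open>E (g - H)\<close> is a subgradient of the total
  variation at \<open>H\<close>, so that \<open>TV f \<ge> TV H + E \<langle>g - H, f - H\<rangle>\<close>.  Here \<open>g - H = (f - H) + v\<close>; since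
  \<open>v\<close> has mean zero it does not see the shift of \<open>H\<close> by its median, and the subgradient inequality
  for \<open>v\<close> gives \<open>\<langle>v, H - f\<rangle> \<le> D H - D f\<close>.  As \<open>TV f = E D f\<close>, this yields
  \<open>TV H + E |H - f|\<^sup>2 \<le> E D H\<close> (lemma \<open>prox_energy_inequality\<close>).  When \<open>H \<noteq> f\<close>, replacing the
  factor 1 by \<open>\<theta> < 1\<close> makes the inequality strict, hence it survives on a neighbourhood of \<open>H\<close>, and
  there division by \<open>D\<close> turns it into the stopping condition.

  The median enters only through the fact that it minimises \<open>c \<mapsto> |u - c|\<close> in the \<open>l1\<close> norm
  (lemma \<open>l1_norm_median_centered_le\<close>): thus \<open>D\<close> is the \<open>l1\<close> distance to the constants, which
  makes \<open>D\<close> Lipschitz, zero exactly on the constants, invariant under shifts and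
  homogeneous under positive scalings.  The last two properties show that the outer update, a shift
  followed by a scaling, does not change the energy.\<close>

section \<open>The median and the distance to the constants\<close>

lemma length_filter_sorted_le_nth:
  fixes xs :: "'a::linorder list"
  assumes "sorted xs" "k < length xs"
  shows "Suc k \<le> length (filter (\<lambda>x. x \<le> xs ! k) xs)"
    and "length xs - k \<le> length (filter (\<lambda>x. xs ! k \<le> x) xs)"
proof -
  have "{..k} \<subseteq> {i. i < length xs \<and> xs ! i \<le> xs ! k}"
    using assms by (auto intro: sorted_nth_mono)
  from card_mono[OF _ this] show "Suc k \<le> length (filter (\<lambda>x. x \<le> xs ! k) xs)"
    by (simp add: length_filter_conv_card)
  have "{k..<length xs} \<subseteq> {i. i < length xs \<and> xs ! k \<le> xs ! i}"
    using assms by (auto intro: sorted_nth_mono)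
  from card_mono[OF _ this] show "length xs - k \<le> length (filter (\<lambda>x. xs ! k \<le> x) xs)"
    by (simp add: length_filter_conv_card)
qed

lemma length_filter_sorted_image_mset:
  fixes h :: "'a::finite \<Rightarrow> 'b::linorder"
  shows "length (filter P (sorted_list_of_multiset (image_mset h (mset_set UNIV))))
       = card {i. P (h i)}"
proof -
  let ?xs = "sorted_list_of_multiset (image_mset h (mset_set UNIV))"
  have "length (filter P ?xs) = size (filter_mset P (mset ?xs))"
    by (metis mset_filter size_mset)
  also have "\<dots> = card {i. P (h i)}"
    by (simp add: filter_mset_image_mset)
  finally show ?thesis .
qed

lemma med_splits_in_halves:
  fixes f :: "real ^ 'n::finite"
  shows "real CARD('n) \<le> 2 * real (card {i. f $ i \<le> med f})"
    and "real CARD('n) \<le> 2 * real (card {i. med f \<le> f $ i})"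
proof -
  let ?xs = "sorted_list_of_multiset (image_mset (($) f) (mset_set (UNIV :: 'n set)))"
  let ?k = "(CARD('n) + 1) div 2 - 1"
  have "0 < CARD('n)" by simp
  moreover have len: "length ?xs = CARD('n)"
    using length_filter_sorted_image_mset[of "\<lambda>_. True" "($) f"] by simp
  ultimately have k: "?k < length ?xs" by linarith
  have med: "?xs ! ?k = med f" by (simp add: med_def)
  have "Suc ?k \<le> card {i. f $ i \<le> med f}"
    using length_filter_sorted_le_nth(1)[OF _ k]
    unfolding med length_filter_sorted_image_mset by simp
  then show "real CARD('n) \<le> 2 * real (card {i. f $ i \<le> med f})"
    using \<open>0 < CARD('n)\<close> by linarith
  have "CARD('n) - ?k \<le> card {i. med f \<le> f $ i}"
    using length_filter_sorted_le_nth(2)[OF _ k]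
    unfolding med length_filter_sorted_image_mset len by simp
  then show "real CARD('n) \<le> 2 * real (card {i. med f \<le> f $ i})"
    using \<open>0 < CARD('n)\<close> by linarith
qed

text \<open>Moving \<open>c\<close> away from a point \<open>m\<close> by \<open>d\<close> lengthens the distance to the entries on the far side
  by \<open>d\<close> and shortens the others by at most \<open>d\<close>; when at least half of the entries lie on the
  far side the total does not decrease.\<close>

lemma sum_abs_mono_of_majority:
  fixes h :: "'n::finite \<Rightarrow> real"
  assumes "\<And>i. i \<in> A \<Longrightarrow> \<bar>h i - m\<bar> + \<bar>c - m\<bar> \<le> \<bar>h i - c\<bar>"
    and "real CARD('n) \<le> 2 * real (card A)"
  shows "(\<Sum>i\<in>UNIV. \<bar>h i - m\<bar>) \<le> (\<Sum>i\<in>UNIV. \<bar>h i - c\<bar>)"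
proof -
  have "0 \<le> \<bar>c - m\<bar> * (2 * real (card A) - real CARD('n))"
    using assms(2) by simp
  also have "\<dots> = (\<Sum>i\<in>UNIV. \<bar>c - m\<bar> * (2 * indicator A i - 1))"
    by (simp add: sum_distrib_left[symmetric] sum_subtractf indicator_def sum.If_cases)
  also have "\<dots> \<le> (\<Sum>i\<in>UNIV. \<bar>h i - c\<bar> - \<bar>h i - m\<bar>)"
  proof (rule sum_mono)
    fix i
    show "\<bar>c - m\<bar> * (2 * indicator A i - 1) \<le> \<bar>h i - c\<bar> - \<bar>h i - m\<bar>"
      using assms(1)[of i] by (cases "i \<in> A") auto
  qed
  finally show ?thesis by (simp add: sum_subtractf)
qed

lemma l1_norm_median_centered_le:
  fixes f :: "real ^ 'n::finite"
  shows "l1_norm (median_centered f) \<le> l1_norm (f - c *\<^sub>R 1)"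
proof -
  have "(\<Sum>i\<in>UNIV. \<bar>f $ i - med f\<bar>) \<le> (\<Sum>i\<in>UNIV. \<bar>f $ i - c\<bar>)"
  proof (cases "med f \<le> c")
    case True
    then show ?thesis
      by (intro sum_abs_mono_of_majority[OF _ med_splits_in_halves(1)[of f]]) auto
  next
    case False
    then show ?thesis
      by (intro sum_abs_mono_of_majority[OF _ med_splits_in_halves(2)[of f]]) auto
  qed
  then show ?thesis by (simp add: l1_norm_def median_centered_def)
qed

lemma l1_norm_nonneg: "0 \<le> l1_norm f"
  by (simp add: l1_norm_def sum_nonneg)

lemma l1_norm_eq_0_iff: "l1_norm f = 0 \<longleftrightarrow> f = 0"
  by (simp add: l1_norm_def sum_nonneg_eq_0_iff vec_eq_iff)

lemma l1_norm_triangle: "l1_norm (f + h) \<le> l1_norm f + l1_norm h"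
  unfolding l1_norm_def sum.distrib[symmetric] by (intro sum_mono) simp

lemma l1_norm_scaleR: "l1_norm (a *\<^sub>R f) = \<bar>a\<bar> * l1_norm f"
  by (simp add: l1_norm_def abs_mult sum_distrib_left)

lemma nonconstant_iff_l1_norm_median_centered_pos:
  "nonconstant f \<longleftrightarrow> 0 < l1_norm (median_centered f)"
proof
  assume "nonconstant f"
  then have "median_centered f \<noteq> 0"
    by (auto simp: nonconstant_def median_centered_def vec_eq_iff) (metis)
  then show "0 < l1_norm (median_centered f)"
    using l1_norm_nonneg[of "median_centered f"] l1_norm_eq_0_iff[of "median_centered f"]
    by linarith
next
  assume pos: "0 < l1_norm (median_centered f)"
  show "nonconstant f"
  proof (rule ccontr)
    assume "\<not> nonconstant f"
    then have "f = (f $ undefined) *\<^sub>R 1"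
      by (simp add: nonconstant_def vec_eq_iff)
    then have "l1_norm (median_centered f) \<le> l1_norm (0 :: real ^ 'a)"
      by (metis l1_norm_median_centered_le diff_self)
    with pos show False by (simp add: l1_norm_def)
  qed
qed

lemma l1_norm_median_centered_shift_scale:
  assumes "0 < a"
  shows "l1_norm (median_centered (a *\<^sub>R (h - c *\<^sub>R 1))) = a * l1_norm (median_centered h)"
proof -
  have le: "l1_norm (median_centered (a *\<^sub>R (h - c *\<^sub>R 1))) \<le> a * l1_norm (median_centered h)"
    if "0 < a" for a c and h :: "real ^ 'a"
  proof -
    have "a *\<^sub>R (h - c *\<^sub>R 1) - (a * (med h - c)) *\<^sub>R 1 = a *\<^sub>R median_centered h"
      by (simp add: median_centered_def algebra_simps)
    then have "l1_norm (median_centered (a *\<^sub>R (h - c *\<^sub>R 1))) \<le> l1_norm (a *\<^sub>R median_centered h)"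
      by (metis l1_norm_median_centered_le)
    with that show ?thesis by (simp add: l1_norm_scaleR)
  qed
  \<comment> \<open>The inverse of a shift followed by a positive scaling is again of this form.\<close>
  have "h = (1 / a) *\<^sub>R (a *\<^sub>R (h - c *\<^sub>R 1) - (- (a * c)) *\<^sub>R 1)"
    using assms by (simp add: algebra_simps)
  then have "l1_norm (median_centered h)
      \<le> 1 / a * l1_norm (median_centered (a *\<^sub>R (h - c *\<^sub>R 1)))"
    using le[of "1 / a" "a *\<^sub>R (h - c *\<^sub>R 1)" "- (a * c)"] assms by simp
  with le[OF assms, of h c] assms show ?thesis by (simp add: field_simps)
qed

lemma continuous_on_l1_norm: "continuous_on S l1_norm"
  unfolding l1_norm_def by (intro continuous_intros)

text \<open>The distance to a fixed set is Lipschitz.\<close>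

lemma l1_norm_median_centered_lipschitz:
  "\<bar>l1_norm (median_centered x) - l1_norm (median_centered y)\<bar> \<le> l1_norm (x - y)"
proof -
  have le: "l1_norm (median_centered x) \<le> l1_norm (median_centered y) + l1_norm (x - y)"
    for x y :: "real ^ 'a"
  proof -
    have "l1_norm (median_centered x) \<le> l1_norm (median_centered y + (x - y))"
      using l1_norm_median_centered_le[of x "med y"] by (simp add: median_centered_def)
    also have "\<dots> \<le> l1_norm (median_centered y) + l1_norm (x - y)"
      by (rule l1_norm_triangle)
    finally show ?thesis .
  qed
  have "l1_norm (y - x) = l1_norm (x - y)"
    by (simp add: l1_norm_def abs_minus_commute)
  with le[of x y] le[of y x] show ?thesis by linarith
qed

lemma tendsto_l1_norm_median_centered:
  assumes "X \<longlonglongrightarrow> x"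
  shows "(\<lambda>m. l1_norm (median_centered (X m))) \<longlonglongrightarrow> l1_norm (median_centered x)"
proof (rule Lim_transform_bound[THEN LIM_zero_cancel])
  show "\<forall>\<^sub>F m in sequentially. norm (l1_norm (median_centered (X m))
      - l1_norm (median_centered x)) \<le> norm (l1_norm (X m - x))"
    using l1_norm_median_centered_lipschitz[of "X _" x]
    by (intro always_eventually) (simp add: l1_norm_nonneg)
  have "(\<lambda>m. X m - x) \<longlonglongrightarrow> 0"
    using assms by (rule LIM_zero)
  moreover have "isCont l1_norm (0 :: real ^ 'a)"
    using continuous_on_l1_norm[of "UNIV :: (real ^ 'a) set"]
    by (simp add: continuous_on_eq_continuous_at)
  ultimately have "(\<lambda>m. l1_norm (X m - x)) \<longlonglongrightarrow> l1_norm (0 :: real ^ 'a)"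
    by (rule isCont_tendsto_compose[rotated])
  then show "(\<lambda>m. l1_norm (X m - x)) \<longlonglongrightarrow> 0"
    by (simp add: l1_norm_def)
qed

section \<open>Total variation and the energy\<close>

lemma tv_norm_nonneg:
  assumes "connected_weighted_graph w"
  shows "0 \<le> tv_norm w f"
  using assms by (simp add: tv_norm_def connected_weighted_graph_def sum_nonneg)

text \<open>If the total variation vanishes, every edge of positive weight joins equal values, and
  connectedness propagates the equality to all of the vertices.\<close>

lemma tv_norm_pos:
  assumes w: "connected_weighted_graph w" and "nonconstant f"
  shows "0 < tv_norm w f"
proof (rule ccontr)
  assume "\<not> 0 < tv_norm w f"
  with tv_norm_nonneg[OF w, of f] have "tv_norm w f = 0" by simp
  moreover have nonneg: "0 \<le> w i j * \<bar>f $ i - f $ j\<bar>" for i j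
    using w by (simp add: connected_weighted_graph_def)
  ultimately have edge: "w i j * \<bar>f $ i - f $ j\<bar> = 0" for i j
    unfolding tv_norm_def
    by (simp only: sum_nonneg_eq_0_iff sum_nonneg finite_class.finite_UNIV nonneg UNIV_I ball_simps)
  have "f $ i = f $ j" for i j
  proof -
    have "(i, j) \<in> {(a, b). 0 < w a b}\<^sup>*"
      using w by (simp add: connected_weighted_graph_def)
    then show ?thesis
    proof (induction rule: rtrancl_induct)
      case (step y z)
      then show ?case using edge[of y z] by simp
    qed simp
  qed
  with \<open>nonconstant f\<close> show False by (auto simp: nonconstant_def)
qed

lemma convex_on_tv_norm:
  assumes "connected_weighted_graph w"
  shows "convex_on UNIV (tv_norm w)"
proof (rule convex_onI)
  fix t :: real and x y :: "real ^ 'a"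
  assume t: "0 < t" "t < 1"
  have "w i j * \<bar>((1 - t) *\<^sub>R x + t *\<^sub>R y) $ i - ((1 - t) *\<^sub>R x + t *\<^sub>R y) $ j\<bar>
      \<le> (1 - t) * (w i j * \<bar>x $ i - x $ j\<bar>) + t * (w i j * \<bar>y $ i - y $ j\<bar>)" for i j
  proof -
    have "((1 - t) *\<^sub>R x + t *\<^sub>R y) $ i - ((1 - t) *\<^sub>R x + t *\<^sub>R y) $ j
        = (1 - t) * (x $ i - x $ j) + t * (y $ i - y $ j)"
      by (simp add: algebra_simps)
    also have "\<bar>\<dots>\<bar> \<le> (1 - t) * \<bar>x $ i - x $ j\<bar> + t * \<bar>y $ i - y $ j\<bar>"
      by (rule order_trans[OF abs_triangle_ineq]) (use t in \<open>simp add: abs_mult\<close>)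
    finally have "w i j * \<bar>((1 - t) *\<^sub>R x + t *\<^sub>R y) $ i - ((1 - t) *\<^sub>R x + t *\<^sub>R y) $ j\<bar>
        \<le> w i j * ((1 - t) * \<bar>x $ i - x $ j\<bar> + t * \<bar>y $ i - y $ j\<bar>)"
      using assms by (intro mult_left_mono) (auto simp: connected_weighted_graph_def)
    then show ?thesis by (simp add: algebra_simps)
  qed
  then show "tv_norm w ((1 - t) *\<^sub>R x + t *\<^sub>R y) \<le> (1 - t) * tv_norm w x + t * tv_norm w y"
    unfolding tv_norm_def sum_distrib_left sum.distrib[symmetric] by (intro sum_mono) blast
qed simp

lemma continuous_on_tv_norm: "continuous_on S (tv_norm w)"
  unfolding tv_norm_def by (intro continuous_intros)

lemma tv_norm_shift_scale:
  assumes "0 < a"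
  shows "tv_norm w (a *\<^sub>R (h - c *\<^sub>R 1)) = a * tv_norm w h"
proof -
  have "w i j * \<bar>a * (h $ i - c) - a * (h $ j - c)\<bar> = a * (w i j * \<bar>h $ i - h $ j\<bar>)" for i j
  proof -
    have "a * (h $ i - c) - a * (h $ j - c) = a * (h $ i - h $ j)"
      by (simp add: algebra_simps)
    then show ?thesis using assms by (simp add: abs_mult)
  qed
  then show ?thesis
    unfolding tv_norm_def sum_distrib_left by (intro sum.cong refl) simp
qed

lemma outer_update_energy:
  assumes "nonconstant h"
  shows "nonconstant (outer_update h)"
    and "balanced_cut_energy w (outer_update h) = balanced_cut_energy w h"
proof -
  define a where "a = 1 / norm (median_centered h)"
  have D: "0 < l1_norm (median_centered h)"
    using assms by (simp add: nonconstant_iff_l1_norm_median_centered_pos)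
  then have "median_centered h \<noteq> 0"
    by (metis l1_norm_eq_0_iff less_irrefl)
  then have a: "0 < a" by (simp add: a_def)
  have upd: "outer_update h = a *\<^sub>R (h - med h *\<^sub>R 1)"
    by (simp add: outer_update_def a_def median_centered_def Let_def)
  show "nonconstant (outer_update h)"
    using D a unfolding nonconstant_iff_l1_norm_median_centered_pos upd
    by (simp add: l1_norm_median_centered_shift_scale)
  show "balanced_cut_energy w (outer_update h) = balanced_cut_energy w h"
    using a unfolding balanced_cut_energy_def upd
    by (simp add: l1_norm_median_centered_shift_scale tv_norm_shift_scale)
qed

section \<open>The proximal step\<close>

text \<open>Outside a large ball around \<open>g\<close> the quadratic term alone exceeds the value at \<open>g\<close>, so
  a minimiser over the ball is global.\<close>

lemma proximal_minimiser_exists: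
  fixes \<phi> :: "'a::euclidean_space \<Rightarrow> real"
  assumes "continuous_on UNIV \<phi>" "\<And>u. 0 \<le> \<phi> u" "0 < c"
  obtains x where "\<And>u. \<phi> x + c / 2 * (norm (x - g))\<^sup>2 \<le> \<phi> u + c / 2 * (norm (u - g))\<^sup>2"
proof -
  define F where "F u = \<phi> u + c / 2 * (norm (u - g))\<^sup>2" for u
  define R where "R = sqrt (2 * \<phi> g / c)"
  have R: "0 \<le> R" "c / 2 * R\<^sup>2 = \<phi> g"
    using assms by (simp_all add: R_def)
  have "continuous_on (cball g R) F"
    unfolding F_def
    by (intro continuous_intros continuous_on_subset[OF assms(1)]) simp
  then obtain x where x: "\<And>u. u \<in> cball g R \<Longrightarrow> F x \<le> F u"
    using continuous_attains_inf[of "cball g R" F] R(1) by (metis compact_cball cball_eq_empty not_less)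
  have "F x \<le> F u" for u
  proof (cases "u \<in> cball g R")
    case False
    then have "R\<^sup>2 \<le> (norm (u - g))\<^sup>2"
      using R(1) by (intro power_mono) (auto simp: dist_norm norm_minus_commute)
    then have "c / 2 * R\<^sup>2 \<le> c / 2 * (norm (u - g))\<^sup>2"
      using assms(3) by (intro mult_left_mono) auto
    then have "F g \<le> F u"
      using assms(2)[of u] R(2) by (simp add: F_def)
    moreover have "F x \<le> F g" using x[of g] R(1) by simp
    ultimately show ?thesis by linarith
  qed (rule x)
  then show thesis using that unfolding F_def by blast
qed

text \<open>The first-order optimality condition, without subdifferential calculus: along the
  segment from the minimiser \<open>x\<close> to \<open>u\<close> the convex part grows at most linearly, and the quadratic
  part agrees with its linearisation up to second order.\<close>

lemma proximal_minimiser_variational: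
  fixes \<phi> :: "'a::real_inner \<Rightarrow> real"
  assumes conv: "convex_on UNIV \<phi>"
    and min: "\<And>u. \<phi> x + c / 2 * (norm (x - g))\<^sup>2 \<le> \<phi> u + c / 2 * (norm (u - g))\<^sup>2"
  shows "\<phi> x + c * ((g - x) \<bullet> (u - x)) \<le> \<phi> u"
proof -
  define A where "A = \<phi> u - \<phi> x - c * ((g - x) \<bullet> (u - x))"
  define B where "B = c / 2 * (norm (u - x))\<^sup>2"
  have "0 \<le> A + t * B" if t: "0 < t" "t < 1" for t
  proof -
    let ?y = "(1 - t) *\<^sub>R x + t *\<^sub>R u"
    have le: "\<phi> ?y \<le> (1 - t) * \<phi> x + t * \<phi> u"
      using convex_onD[OF conv, of t x u] t by simp
    have "?y - g = (x - g) + t *\<^sub>R (u - x)"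
      by (simp add: algebra_simps)
    then have quad: "(norm (?y - g))\<^sup>2
        = (norm (x - g))\<^sup>2 - 2 * t * ((g - x) \<bullet> (u - x)) + t\<^sup>2 * (norm (u - x))\<^sup>2"
      unfolding power2_norm_eq_inner
      by (simp add: inner_simps inner_commute power2_eq_square algebra_simps)
    have "\<phi> x + c / 2 * (norm (x - g))\<^sup>2 \<le> (1 - t) * \<phi> x + t * \<phi> u
        + c / 2 * ((norm (x - g))\<^sup>2 - 2 * t * ((g - x) \<bullet> (u - x)) + t\<^sup>2 * (norm (u - x))\<^sup>2)"
      using le min[of ?y] unfolding quad by linarith
    also have "\<dots> = \<phi> x + c / 2 * (norm (x - g))\<^sup>2 + t * (A + t * B)"
      unfolding A_def B_def by algebra
    finally have "0 \<le> t * (A + t * B)" by simp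
    with t show ?thesis by (simp add: zero_le_mult_iff)
  qed
  then have "\<forall>\<^sub>F t in at_right 0. 0 \<le> A + t * B"
    unfolding eventually_at_right_field by (intro exI[of _ 1]) auto
  moreover have "((\<lambda>t. A + t * B) \<longlongrightarrow> A + 0 * B) (at_right 0)"
    by (intro tendsto_intros)
  ultimately have "0 \<le> A + 0 * B"
    by (intro tendsto_lowerbound) auto
  then show ?thesis by (simp add: A_def)
qed

lemma l1_subdifferential0_le:
  assumes "v \<in> l1_subdifferential0 f"
  shows "v \<bullet> (u - f) \<le> l1_norm (median_centered u) - l1_norm f"
proof -
  have "v \<bullet> 1 = 0"
    using assms by (simp add: l1_subdifferential0_def mean_def inner_vec_def)
  then have "v \<bullet> (u - f) = v \<bullet> (median_centered u - f)"
    by (simp add: median_centered_def inner_diff_right)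
  also have "\<dots> \<le> l1_norm (median_centered u) - l1_norm f"
    using assms by (simp add: l1_subdifferential0_def l1_subdifferential_def)
  finally show ?thesis .
qed

lemma median_zero_sphere_nonconstant:
  assumes "f \<in> median_zero_sphere"
  shows "nonconstant f" and "median_centered f = f"
proof -
  show centered: "median_centered f = f"
    using assms by (simp add: median_zero_sphere_def median_centered_def)
  have "f \<noteq> 0" using assms by (auto simp: median_zero_sphere_def)
  then have "0 < l1_norm f"
    using l1_norm_nonneg[of f] l1_norm_eq_0_iff[of f] by linarith
  then show "nonconstant f"
    by (simp add: nonconstant_iff_l1_norm_median_centered_pos centered)
qed

lemma balanced_cut_energy_pos:
  assumes "connected_weighted_graph w" "nonconstant f"
  shows "0 < balanced_cut_energy w f"
  using tv_norm_pos[OF assms] assms(2)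
  by (simp add: balanced_cut_energy_def nonconstant_iff_l1_norm_median_centered_pos)

lemma prox_energy_inequality:
  assumes w: "connected_weighted_graph w" and f: "f \<in> median_zero_sphere"
    and v: "v \<in> l1_subdifferential0 f"
    and H: "H = inner_argmin w f (f + v)"
  shows "tv_norm w H + balanced_cut_energy w f * (norm (H - f))\<^sup>2
       \<le> balanced_cut_energy w f * l1_norm (median_centered H)"
proof -
  define E where "E = balanced_cut_energy w f"
  have E: "0 < E"
    unfolding E_def using w median_zero_sphere_nonconstant(1)[OF f]
    by (rule balanced_cut_energy_pos)
  define F where "F u = tv_norm w u + E / 2 * (norm (u - (f + v)))\<^sup>2" for u
  obtain x where "\<And>u. F x \<le> F u"
    using proximal_minimiser_exists[OF continuous_on_tv_norm tv_norm_nonneg[OF w] E, of "f + v"]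
    unfolding F_def by blast
  then have "is_arg_min F (\<lambda>_. True) x"
    by (simp add: is_arg_min_linorder)
  then have "is_arg_min F (\<lambda>_. True) (arg_min F (\<lambda>_. True))"
    unfolding arg_min_def by (rule someI)
  moreover have "H = arg_min F (\<lambda>_. True)"
    unfolding H inner_argmin_def F_def E_def ..
  ultimately have "F H \<le> F u" for u
    by (simp add: is_arg_min_linorder)
  then have "tv_norm w H + E * ((f + v - H) \<bullet> (f - H)) \<le> tv_norm w f"
    unfolding F_def by (rule proximal_minimiser_variational[OF convex_on_tv_norm[OF w]])
  moreover have inner: "(f + v - H) \<bullet> (f - H) = (norm (H - f))\<^sup>2 - v \<bullet> (H - f)"
    unfolding power2_norm_eq_inner by (simp add: inner_simps inner_commute)
  moreover have "E * (v \<bullet> (H - f)) \<le> E * (l1_norm (median_centered H) - l1_norm f)"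
    using l1_subdifferential0_le[OF v] E by (intro mult_left_mono) auto
  moreover have "tv_norm w f = E * l1_norm f"
    using median_zero_sphere_nonconstant[OF f]
    by (auto simp: E_def balanced_cut_energy_def nonconstant_iff_l1_norm_median_centered_pos)
  ultimately show ?thesis
    unfolding E_def[symmetric] inner right_diff_distrib by linarith
qed

section \<open>Stopping and energy decrease\<close>

text \<open>The form of the stopping condition without division is an open condition on \<open>u\<close>; it
  includes non-constancy because its left-hand side is nonnegative.\<close>

lemma stopping_conditionI:
  assumes w: "connected_weighted_graph w" and f: "nonconstant f" and "0 < \<theta>"
    and less: "tv_norm w u + \<theta> * balanced_cut_energy w f * (norm (u - f))\<^sup>2
             < balanced_cut_energy w f * l1_norm (median_centered u)"
  shows "stopping_condition w \<theta> f u"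
proof -
  have E: "0 < balanced_cut_energy w f"
    using w f by (rule balanced_cut_energy_pos)
  then have "0 \<le> tv_norm w u + \<theta> * balanced_cut_energy w f * (norm (u - f))\<^sup>2"
    using tv_norm_nonneg[OF w] \<open>0 < \<theta>\<close> by (intro add_nonneg_nonneg) auto
  with less have "0 < balanced_cut_energy w f * l1_norm (median_centered u)" by linarith
  with E have D: "0 < l1_norm (median_centered u)" by (simp add: zero_less_mult_iff)
  have "balanced_cut_energy w u
      + \<theta> * balanced_cut_energy w f * (norm (u - f))\<^sup>2 / l1_norm (median_centered u)
      = (tv_norm w u + \<theta> * balanced_cut_energy w f * (norm (u - f))\<^sup>2)
        / l1_norm (median_centered u)"
    by (simp add: balanced_cut_energy_def[of w u] add_divide_distrib)
  also have "\<dots> < balanced_cut_energy w f"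
    using less D by (simp add: pos_divide_less_eq)
  finally show ?thesis
    using D by (simp add: stopping_condition_def nonconstant_iff_l1_norm_median_centered_pos)
qed

lemma stopping_condition_energy_less:
  assumes w: "connected_weighted_graph w" and f: "nonconstant f" and "0 < \<theta>"
    and "stopping_condition w \<theta> f u"
  shows "balanced_cut_energy w u < balanced_cut_energy w f"
proof -
  have "0 \<le> \<theta> * balanced_cut_energy w f * (norm (u - f))\<^sup>2 / l1_norm (median_centered u)"
    using \<open>0 < \<theta>\<close> balanced_cut_energy_pos[OF w f] l1_norm_nonneg
    by (intro divide_nonneg_nonneg mult_nonneg_nonneg) auto
  with assms(4) show ?thesis by (simp add: stopping_condition_def)
qed

theorem mainTheorem1:
  fixes w :: "'n::finite \<Rightarrow> 'n \<Rightarrow> real"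
    and f v g H :: "real ^ 'n"
    and \<Phi> :: "nat \<Rightarrow> real ^ 'n"
    and \<theta> :: real
  assumes "connected_weighted_graph w"
    and "f \<in> median_zero_sphere"
    and "v \<in> l1_subdifferential0 f"
    and "g = f + v"
    and "0 < \<theta>" and "\<theta> < 1"
    and "H = inner_argmin w f g"
    and "\<Phi> 1 = f"
    and "\<Phi> \<longlonglongrightarrow> H"
    and "H \<noteq> f"
  shows "(\<forall>\<^sub>F m in sequentially. stopping_condition w \<theta> f (\<Phi> m)) \<and>
    (\<exists>m\<ge>1. stopping_condition w \<theta> f (\<Phi> m)) \<and>
    (let M = (LEAST m. 1 \<le> m \<and> stopping_condition w \<theta> f (\<Phi> m));
         f_next = outer_update (\<Phi> M)
     in nonconstant f_next \<and> balanced_cut_energy w f_next < balanced_cut_energy w f)"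
proof -
  define E where "E = balanced_cut_energy w f"
  have f: "nonconstant f"
    using assms(2) by (rule median_zero_sphere_nonconstant)
  have E: "0 < E"
    unfolding E_def using assms(1) f by (rule balanced_cut_energy_pos)
  have "\<theta> * E * (norm (H - f))\<^sup>2 < E * (norm (H - f))\<^sup>2"
    using \<open>\<theta> < 1\<close> \<open>H \<noteq> f\<close> E by simp
  then have strict: "tv_norm w H + \<theta> * E * (norm (H - f))\<^sup>2 < E * l1_norm (median_centered H)"
    using prox_energy_inequality[OF assms(1-3)] assms(4,7) by (fastforce simp: E_def)
  have "isCont (tv_norm w) H"
    using continuous_on_tv_norm[of "UNIV :: (real ^ 'n) set"]
    by (simp add: continuous_on_eq_continuous_at)
  then have "(\<lambda>m. tv_norm w (\<Phi> m)) \<longlonglongrightarrow> tv_norm w H"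
    using assms(9) by (rule isCont_tendsto_compose)
  then have lhs: "(\<lambda>m. tv_norm w (\<Phi> m) + \<theta> * E * (norm (\<Phi> m - f))\<^sup>2)
      \<longlonglongrightarrow> tv_norm w H + \<theta> * E * (norm (H - f))\<^sup>2"
    using assms(9) by (intro tendsto_intros)
  have rhs: "(\<lambda>m. E * l1_norm (median_centered (\<Phi> m))) \<longlonglongrightarrow> E * l1_norm (median_centered H)"
    using assms(9) by (intro tendsto_intros tendsto_l1_norm_median_centered)
  have "((\<lambda>m. E * l1_norm (median_centered (\<Phi> m)) - (tv_norm w (\<Phi> m) + \<theta> * E * (norm (\<Phi> m - f))\<^sup>2))
      \<longlonglongrightarrow> E * l1_norm (median_centered H) - (tv_norm w H + \<theta> * E * (norm (H - f))\<^sup>2))"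
    using rhs lhs by (rule tendsto_diff)
  then have "\<forall>\<^sub>F m in sequentially.
      0 < E * l1_norm (median_centered (\<Phi> m)) - (tv_norm w (\<Phi> m) + \<theta> * E * (norm (\<Phi> m - f))\<^sup>2)"
    using strict by (intro order_tendstoD(1)) auto
  then have ev: "\<forall>\<^sub>F m in sequentially. stopping_condition w \<theta> f (\<Phi> m)"
  proof eventually_elim
    case (elim m)
    then show ?case
      by (intro stopping_conditionI[OF assms(1) f \<open>0 < \<theta>\<close>]) (simp add: E_def)
  qed
  then have "\<forall>\<^sub>F m in sequentially. 1 \<le> m \<and> stopping_condition w \<theta> f (\<Phi> m)"
    using eventually_ge_at_top[of "1::nat"] by eventually_elim simp
  then have ex: "\<exists>m. 1 \<le> m \<and> stopping_condition w \<theta> f (\<Phi> m)"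
    by (rule eventually_happens'[OF sequentially_bot])
  define M where "M = (LEAST m. 1 \<le> m \<and> stopping_condition w \<theta> f (\<Phi> m))"
  have M: "stopping_condition w \<theta> f (\<Phi> M)"
    using LeastI_ex[OF ex] by (simp add: M_def)
  then have nc: "nonconstant (\<Phi> M)"
    by (simp add: stopping_condition_def)
  have "balanced_cut_energy w (\<Phi> M) < balanced_cut_energy w f"
    using assms(1) f \<open>0 < \<theta>\<close> M by (rule stopping_condition_energy_less)
  then have "nonconstant (outer_update (\<Phi> M)) \<and>
      balanced_cut_energy w (outer_update (\<Phi> M)) < balanced_cut_energy w f"
    using outer_update_energy[OF nc] by simp
  with ev ex show ?thesis
    unfolding M_def Let_def by blast
qed

end
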